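(* Let $\psi = h(\theta)$ be a scalar focus parameter with maximum likelihood estimator $\hat\psi = h(\hat\theta)$, and let $B_{(\psi)} = \mathrm{E}(\hat\psi - \psi)$, $K_2 = \mathrm{Var}(\hat\psi)$, $K_3 = \mathrm{Cum}_3(\hat\psi)$ and $\rho_3 = K_2^{-3/2} K_3$ be, respectively, the bias, variance, third cumulant and standardized third cumulant of $\hat\psi$ under the model $\mathcal{M}_\theta$. Assume that $K_2$, $\rho_3$ and $B_{(\psi)}$ are known. Let $W = K_2^{-1/2}\{\hat\psi - \mathrm{E}(\hat\psi)\} = K_2^{-1/2}(\hat\psi - \psi - B_{(\psi)})$ and $$Z = W - \frac{\rho_3}{6}\,(W^2 - 1).$$ Let $\tilde\psi^{(a)}$ be the solution of the oracle estimating equation $Z = 0$ with respect to $\psi$ (with the known quantities $K_2$, $\rho_3$, $B_{(\psi)}$ held fixed), corresponding to the root with $W = O_p(n^{-1/2})$. Then $\tilde\psi^{(a)}$ is third-order median unbiased, that is, $$P(\tilde\psi^{(a)} \le \psi) = \frac{1}{2} + O(n^{-3/2}) \quad \text{as } n \to \infty,$$ where $\psi$ on the left-hand side of the inequality in the event denotes the true value $h(\theta)$ and the probability is under $\mathcal{M}_\theta$.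
   Context: Setting. $\mathcal{M}_\theta$ is a parametric model with parameter $\theta = (\theta_1,\ldots,\theta_p)^\top \in \Theta \subset \mathbb{R}^p$ and log-likelihood $l(\theta; y)$ at an observed realization $y$ of a random vector $Y$ distributed according to $\mathcal{M}_\theta$. The maximum likelihood estimator is $\hat\theta = \arg\max_{\theta\in\Theta} l(\theta; Y)$. The function $h:\Theta \to H \subset \mathbb{R}$ is smooth. All probabilities, expectations, cumulants and asymptotic statements are under $\mathcal{M}_\theta$, with $\theta$ fixed. The index $n$ characterizes the rate at which information about $\theta$ (and $\psi$) accumulates as the sample size grows, and asymptotics are as $n \to \infty$. Standing assumptions. The distribution $\mathcal{M}_\theta$ is continuous. The log-likelihood has continuous partial derivatives up to the required order, expectations of products of those derivatives are finite up to the required order, and the standard regularity conditions for parametric likelihood inference hold. In particular $B_{(\psi)} = O(n^{-1})$, $0 < K_2 = O(n^{-1})$, $\rho_3 = O(n^{-1/2})$, and $W$ is asymptotically standard normal. The usual regularity conditions for the validity of Edgeworth and Cornish-Fisher expansions hold for $W$: uniformly in $x \in \mathbb{R}$, $$P(W \le x) = \Phi(x) - \phi(x)\left\{\frac{\rho_3}{6}(x^2 - 1) + r_n(x)\right\} + O(n^{-3/2}),$$ where $\Phi$ and $\phi$ are the standard normal distribution function and density, and $r_n(x)$ is a linear combination, with coefficients of order $O(n^{-1})$, of the odd Hermite polynomials $H_3(x) = x^3 - 3x$ and $H_5(x) = x^5 - 10x^3 + 15x$. *)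

theory Defs
  imports "HOL-Probability.Probability" "HOL-Library.Landau_Symbols"
begin

text \<open>
  A continuous random vector with \<open>d\<close> components takes its values in the extensional functions on
  \<open>{..<d}\<close>. Its log-likelihood \<open>l\<close> is the logarithm of its Lebesgue density on the sample space
  \<open>S\<close>, where that density is positive.
\<close>

definition lik_model :: "nat \<Rightarrow> (nat \<Rightarrow> real) set \<Rightarrow> ((nat \<Rightarrow> real) \<Rightarrow> real) \<Rightarrow> (nat \<Rightarrow> real) measure"
  where "lik_model d S l =
    density (restrict_space (\<Pi>\<^sub>M i\<in>{..<d}. lborel) S) (\<lambda>y. ennreal (exp (l y)))"

primrec iter_partial :: "(real ^ 'p \<Rightarrow> real) \<Rightarrow> 'p::finite list \<Rightarrow> real ^ 'p \<Rightarrow> real"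
  where
    "iter_partial f [] = f"
  | "iter_partial f (i # js) = (\<lambda>x. deriv (\<lambda>t. iter_partial f js (x + t *\<^sub>R axis i 1)) 0)"

text \<open>On a set that is not open, being of class \<open>C\<^sup>k\<close> means having a \<open>C\<^sup>k\<close> extension to an open set.\<close>

definition Ck_on :: "nat \<Rightarrow> (real ^ 'p::finite \<Rightarrow> real) \<Rightarrow> (real ^ 'p) set \<Rightarrow> bool"
  where "Ck_on k f A \<longleftrightarrow>
    (\<exists>U g. open U \<and> A \<subseteq> U \<and> (\<forall>x\<in>A. g x = f x) \<and>
      (\<forall>js. length js \<le> k \<longrightarrow> continuous_on U (iter_partial g js)) \<and>
      (\<forall>js i. length js < k \<longrightarrow>
        (\<forall>x\<in>U. (\<lambda>t. iter_partial g js (x + t *\<^sub>R axis i 1)) differentiable (at 0))))"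

definition smooth_on :: "(real ^ 'p::finite \<Rightarrow> real) \<Rightarrow> (real ^ 'p) set \<Rightarrow> bool"
  where "smooth_on f A \<longleftrightarrow>
    (\<exists>U g. open U \<and> A \<subseteq> U \<and> (\<forall>x\<in>A. g x = f x) \<and> (\<forall>k. Ck_on k g U))"

text \<open>
  The third cumulant by the moment-cumulant formula, that is, the sum over the partitions of a
  three-element set.
\<close>

definition variance_of :: "'a measure \<Rightarrow> ('a \<Rightarrow> real) \<Rightarrow> real"
  where "variance_of M X = (LINT y|M. (X y - (LINT z|M. X z))\<^sup>2)"

definition cum3 :: "'a measure \<Rightarrow> ('a \<Rightarrow> real) \<Rightarrow> real"
  where "cum3 M X =
    (LINT y|M. X y ^ 3) - 3 * (LINT y|M. X y ^ 2) * (LINT y|M. X y) + 2 * (LINT y|M. X y) ^ 3"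

definition hermite3 :: "real \<Rightarrow> real" where "hermite3 x = x ^ 3 - 3 * x"

definition hermite5 :: "real \<Rightarrow> real" where "hermite5 x = x ^ 5 - 10 * x ^ 3 + 15 * x"

definition edgeworth_expansion ::
    "(nat \<Rightarrow> 'a measure) \<Rightarrow> (nat \<Rightarrow> 'a \<Rightarrow> real) \<Rightarrow> (nat \<Rightarrow> real) \<Rightarrow> bool"
  where "edgeworth_expansion M W \<rho> \<longleftrightarrow>
    (\<exists>a b C. a \<in> O(\<lambda>n. 1 / real n) \<and> b \<in> O(\<lambda>n. 1 / real n) \<and>
      (\<forall>\<^sub>F n in sequentially. \<forall>x.
        \<bar>measure (M n) {y \<in> space (M n). W n y \<le> x}
          - (cdf std_normal_distribution x - std_normal_density x *
              (\<rho> n / 6 * (x\<^sup>2 - 1) + (a n * hermite3 x + b n * hermite5 x)))\<bar>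
        \<le> C * real n powr (-3/2)))"

text \<open>\<open>X n = O\<^sub>p(a n)\<close>, the probability at index \<open>n\<close> being taken under \<open>M n\<close>.\<close>

definition bigo_in_prob ::
    "(nat \<Rightarrow> 'a measure) \<Rightarrow> (nat \<Rightarrow> 'a \<Rightarrow> real) \<Rightarrow> (nat \<Rightarrow> real) \<Rightarrow> bool"
  where "bigo_in_prob M X a \<longleftrightarrow>
    (\<forall>\<epsilon>>0. \<exists>C. \<forall>\<^sub>F n in sequentially.
      measure (M n) {y \<in> space (M n). \<bar>X n y\<bar> > C * a n} < \<epsilon>)"

text \<open>Here \<open>x\<close> is the estimate and \<open>\<psi>\<close> a candidate value of the focus parameter.\<close>

definition W_stat :: "real \<Rightarrow> real \<Rightarrow> real \<Rightarrow> real \<Rightarrow> real"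
  where "W_stat K\<^sub>2 B x \<psi> = K\<^sub>2 powr (-1/2) * (x - \<psi> - B)"

definition Z_stat :: "real \<Rightarrow> real \<Rightarrow> real \<Rightarrow> real \<Rightarrow> real \<Rightarrow> real"
  where "Z_stat K\<^sub>2 \<rho> B x \<psi> = W_stat K\<^sub>2 B x \<psi> - \<rho> / 6 * ((W_stat K\<^sub>2 B x \<psi>)\<^sup>2 - 1)"

text \<open>
  In terms of \<open>W\<close>, the equation \<open>Z = 0\<close> is a quadratic equation whose coefficients do not depend
  on the data, and its root of order \<open>n\<^bsup>-1/2\<^esup>\<close> is one of its at most two nonrandom roots. This is
  the second clause: for given \<open>n\<close>, the same root in \<open>W\<close> is taken at all sample points. The third
  clause alone would allow the other root to be taken on events whose probability tends to 0
  arbitrarily slowly.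
\<close>

definition oracle_root ::
    "(nat \<Rightarrow> 'a measure) \<Rightarrow> (nat \<Rightarrow> real) \<Rightarrow> (nat \<Rightarrow> real) \<Rightarrow> (nat \<Rightarrow> real) \<Rightarrow>
      (nat \<Rightarrow> 'a \<Rightarrow> real) \<Rightarrow> (nat \<Rightarrow> 'a \<Rightarrow> real) \<Rightarrow> bool"
  where "oracle_root M K\<^sub>2 \<rho> B X \<psi> \<longleftrightarrow>
    (\<forall>\<^sub>F n in sequentially. \<forall>y\<in>space (M n). Z_stat (K\<^sub>2 n) (\<rho> n) (B n) (X n y) (\<psi> n y) = 0) \<and>
    (\<forall>\<^sub>F n in sequentially. \<exists>w. \<forall>y\<in>space (M n). W_stat (K\<^sub>2 n) (B n) (X n y) (\<psi> n y) = w) \<and>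
    bigo_in_prob M (\<lambda>n y. W_stat (K\<^sub>2 n) (B n) (X n y) (\<psi> n y)) (\<lambda>n. real n powr (-1/2))"

lemma oracle_root_exists:
  fixes K\<^sub>2 \<rho> B :: "nat \<Rightarrow> real"
  assumes K: "\<forall>\<^sub>F n in sequentially. K\<^sub>2 n > 0"
    and \<rho>: "\<rho> \<in> O(\<lambda>n. real n powr (-1/2))"
  shows "\<exists>\<psi>. oracle_root M K\<^sub>2 \<rho> B X \<psi>"
proof -
  define w where "w n = - \<rho> n / (3 + sqrt (9 + (\<rho> n)\<^sup>2))" for n
  define \<psi> where "\<psi> n y = X n y - B n - sqrt (K\<^sub>2 n) * w n" for n y
  have W: "W_stat (K\<^sub>2 n) (B n) (X n y) (\<psi> n y) = w n" if "K\<^sub>2 n > 0" for n y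
  proof -
    have "K\<^sub>2 n powr (-1/2) * sqrt (K\<^sub>2 n) = 1"
      using that by (simp add: powr_half_sqrt[symmetric] powr_add[symmetric])
    then show ?thesis
      by (simp add: W_stat_def \<psi>_def flip: mult.assoc)
  qed
  have quad: "w n - \<rho> n / 6 * ((w n)\<^sup>2 - 1) = 0" for n
  proof -
    define s where "s = sqrt (9 + (\<rho> n)\<^sup>2)"
    have s: "s\<^sup>2 = 9 + (\<rho> n)\<^sup>2" "s \<ge> 0" by (auto simp: s_def)
    then have p: "3 + s \<noteq> 0" by linarith
    have w: "w n * (3 + s) = - \<rho> n" using p by (simp add: w_def s_def[symmetric])
    have "(6 * w n - \<rho> n * ((w n)\<^sup>2 - 1)) * (3 + s)\<^sup>2
        = 6 * (w n * (3 + s)) * (3 + s) - \<rho> n * ((w n * (3 + s))\<^sup>2 - (3 + s)\<^sup>2)"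
      by algebra
    also have "\<dots> = \<rho> n * (s\<^sup>2 - 9 - (\<rho> n)\<^sup>2)" unfolding w by algebra
    also have "\<dots> = 0" using s by simp
    finally have "6 * w n - \<rho> n * ((w n)\<^sup>2 - 1) = 0" using p by simp
    then show ?thesis by (simp add: field_simps)
  qed
  have wle: "\<bar>w n\<bar> \<le> \<bar>\<rho> n\<bar>" for n
  proof -
    have "1 \<le> 3 + sqrt (9 + (\<rho> n)\<^sup>2)" by (smt (verit) real_sqrt_ge_zero zero_le_power2)
    then show ?thesis by (simp add: w_def abs_divide divide_le_eq mult_left_le
          mult_le_cancel_left1 split: if_splits)
  qed
  obtain C where C: "\<forall>\<^sub>F n in sequentially. norm (\<rho> n) \<le> C * norm (real n powr (-1/2))"
    using \<rho> by (elim landau_o.bigE)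
  have "bigo_in_prob M (\<lambda>n y. W_stat (K\<^sub>2 n) (B n) (X n y) (\<psi> n y)) (\<lambda>n. real n powr (-1/2))"
    unfolding bigo_in_prob_def
  proof (intro allI impI exI[of _ C])
    fix \<epsilon> :: real assume e: "\<epsilon> > 0"
    show "\<forall>\<^sub>F n in sequentially. measure (M n) {y \<in> space (M n).
        \<bar>W_stat (K\<^sub>2 n) (B n) (X n y) (\<psi> n y)\<bar> > C * real n powr (-1/2)} < \<epsilon>"
      using K C
    proof eventually_elim
      case (elim n)
      have "\<not> \<bar>w n\<bar> > C * real n powr (-1/2)" using wle[of n] elim by simp
      then show ?case using e elim by (simp add: W)
    qed
  qed
  moreover have "\<forall>\<^sub>F n in sequentially. \<forall>y\<in>space (M n).
      Z_stat (K\<^sub>2 n) (\<rho> n) (B n) (X n y) (\<psi> n y) = 0"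
    using K by eventually_elim (intro ballI, simp only: Z_stat_def W quad)
  moreover have "\<forall>\<^sub>F n in sequentially. \<exists>w. \<forall>y\<in>space (M n).
      W_stat (K\<^sub>2 n) (B n) (X n y) (\<psi> n y) = w"
    using K by eventually_elim (auto simp: W)
  ultimately show ?thesis unfolding oracle_root_def by blast
qed

end

theory Submission
  imports Defs
begin

text \<open>
  Since \<open>Z = 0\<close> has nonrandom coefficients in \<open>W\<close>, the relevant root is a constant \<open>w = O(n powr (-1/2))\<close>
  with \<open>w = \<rho> / 6 * (w\<^sup>2 - 1)\<close>, and the event that the estimate is at most the true value is
  \<open>W \<le> w\<close>. The Edgeworth expansion at \<open>w\<close> gives its probability as \<open>\<Phi> w - w * \<phi> w\<close> up to
  \<open>O(n powr (-3/2))\<close>, the odd Hermite polynomials contributing a factor \<open>w\<close> times coefficients of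
  order \<open>1 / n\<close>; and \<open>\<Phi> w - w * \<phi> w\<close> differs from \<open>1 / 2\<close> only by \<open>O(w ^ 3)\<close>.
\<close>

section \<open>The standard normal distribution function near 0\<close>

lemma std_normal_density_le_1: "std_normal_density x \<le> 1"
proof -
  have "1 \<le> sqrt (2 * pi)" using pi_gt3 by simp
  moreover have "exp (- (x\<^sup>2) / 2) \<le> 1" by simp
  ultimately have "exp (- (x\<^sup>2) / 2) \<le> sqrt (2 * pi)" by (rule order.trans[rotated])
  then show ?thesis by (simp add: std_normal_density_def divide_le_eq)
qed

lemma DERIV_std_normal_density:
  "(std_normal_density has_real_derivative - x * std_normal_density x) (at x)"
  unfolding std_normal_density_def [abs_def]
  by (auto intro!: derivative_eq_intros simp: field_simps)

lemma measure_std_normal: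
  assumes "A \<in> sets borel"
  shows "measure std_normal_distribution A = (LINT x:A|lborel. std_normal_density x)"
proof -
  have "measure std_normal_distribution A = (LINT x|std_normal_distribution. indicator A x)"
    using assms by simp
  also have "\<dots> = (LINT x|lborel. std_normal_density x * indicator A x)"
    using assms by (subst integral_density) auto
  finally show ?thesis by (simp add: set_lebesgue_integral_def mult.commute)
qed

text \<open>The density is even, so reflection gives the two closed half-lines at 0 equal mass.
  Dropping the null point 0 from one of them makes them complementary.\<close>

lemma cdf_std_normal_0: "cdf std_normal_distribution 0 = 1 / 2"
proof -
  interpret real_distribution std_normal_distribution by (rule real_dist_normal_dist)
  have "prob {..0} = (LINT x:{..0}|lborel. std_normal_density x)"
    by (simp add: measure_std_normal)
  also have "\<dots> = (LINT x:{0..}|lborel. std_normal_density x)"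
    by (subst set_integral_reflect) (simp add: std_normal_density_def [abs_def] atLeast_def)
  also have "\<dots> = (LINT x:{0<..}|lborel. std_normal_density x)"
  proof (rule set_integral_null_delta)
    have "{0..} - {0<..} \<union> ({0<..} - {0..}) = {0::real}" by auto
    then show "{0..} - {0<..} \<union> ({0<..} - {0..}) \<in> null_sets (lborel :: real measure)"
      by (simp add: finite_imp_null_set_lborel)
  qed auto
  also have "\<dots> = prob {0<..}"
    by (simp add: measure_std_normal)
  also have "{0<..} = space std_normal_distribution - {..0::real}"
    by auto
  also have "prob \<dots> = 1 - prob {..0}"
    by (rule prob_compl) simp
  finally show ?thesis by (simp add: cdf_def)
qed

text \<open>Near \<open>x\<close>, the distribution function is its value at \<open>x - 1\<close>
  plus an integral over a compact interval, so the fundamental theorem of calculus applies with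
  \<open>x\<close> an interior point.\<close>

lemma DERIV_cdf_std_normal:
  "(cdf std_normal_distribution has_real_derivative std_normal_density x) (at x)"
proof -
  interpret real_distribution std_normal_distribution by (rule real_dist_normal_dist)
  let ?I = "\<lambda>y. integral {x - 1..y} std_normal_density"
  have cont: "continuous_on A std_normal_density" for A
    by (rule DERIV_continuous_on, rule has_field_derivative_at_within, rule DERIV_std_normal_density)
  have cdf: "cdf std_normal_distribution (x - 1) + ?I y = cdf std_normal_distribution y"
    if "y \<in> {x - 1<..<x + 1}" for y
  proof -
    have "cdf std_normal_distribution y - cdf std_normal_distribution (x - 1) = prob {x - 1<..y}"
      using that by (intro cdf_diff_eq) simp
    also have "\<dots> = (LINT z:{x - 1<..y}|lborel. std_normal_density z)"
      by (rule measure_std_normal) simp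
    \<comment> \<open>A difference of distribution functions gives a half-open interval; the left
      endpoint added here is a null set.\<close>
    also have "\<dots> = (LINT z:{x - 1..y}|lborel. std_normal_density z)"
    proof (rule set_integral_null_delta)
      have "{x - 1<..y} - {x - 1..y} \<union> ({x - 1..y} - {x - 1<..y}) \<subseteq> {x - 1}" by auto
      then show "{x - 1<..y} - {x - 1..y} \<union> ({x - 1..y} - {x - 1<..y}) \<in> null_sets lborel"
        by (intro finite_imp_null_set_lborel) (rule finite_subset, auto)
    qed auto
    also have "\<dots> = ?I y"
      by (intro set_borel_integral_eq_integral borel_integrable_atLeastAtMost' cont)
    finally show ?thesis by simp
  qed
  have "(?I has_real_derivative std_normal_density x) (at x within {x - 1..x + 1})"
    by (rule integral_has_real_derivative[OF cont]) simp
  then have "(?I has_real_derivative std_normal_density x) (at x)"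
    by (simp add: at_within_Icc_at)
  then have "((\<lambda>y. cdf std_normal_distribution (x - 1) + ?I y)
      has_real_derivative std_normal_density x) (at x)"
    using DERIV_add[OF DERIV_const] by fastforce
  then show ?thesis
    by (rule has_field_derivative_transform_within_open[where S = "{x - 1<..<x + 1}"])
      (use cdf in auto)
qed

text \<open>Since the density satisfies \<phi>' = -x \<phi>, the derivative of \<Phi> x - x \<phi> x
  is x^2 \<phi> x: the terms of lower order cancel. Between 0 and \<open>w\<close> it is at most
  \<open>w\<^sup>2\<close>, and the mean value inequality supplies the third factor.\<close>

lemma cdf_std_normal_taylor:
  "\<bar>cdf std_normal_distribution w - 1 / 2 - w * std_normal_density w\<bar> \<le> \<bar>w\<bar> ^ 3"
proof -
  define g where "g x = cdf std_normal_distribution x - x * std_normal_density x" for x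
  have g': "(g has_real_derivative x\<^sup>2 * std_normal_density x) (at x)" for x
    unfolding g_def [abs_def]
    by (auto intro!: derivative_eq_intros DERIV_cdf_std_normal DERIV_std_normal_density simp: power2_eq_square algebra_simps)
  have "norm (g w - g 0) \<le> w\<^sup>2 * norm (w - 0)"
  proof (rule field_differentiable_bound[where S = "closed_segment 0 w"])
    show "(g has_field_derivative x\<^sup>2 * std_normal_density x) (at x within closed_segment 0 w)" for x
      using g' by (rule has_field_derivative_at_within)
    show "norm (x\<^sup>2 * std_normal_density x) \<le> w\<^sup>2" if "x \<in> closed_segment 0 w" for x
    proof -
      have "\<bar>x\<bar> \<le> \<bar>w\<bar>" using that by (auto simp: closed_segment_eq_real_ivl split: if_splits)
      then have "x\<^sup>2 * std_normal_density x \<le> w\<^sup>2 * 1"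
        by (intro mult_mono std_normal_density_le_1) (simp_all add: abs_le_square_iff)
      then show ?thesis by (simp add: abs_mult)
    qed
  qed auto
  then show ?thesis by (simp add: g_def cdf_std_normal_0 power3_eq_cube power2_eq_square abs_mult algebra_simps)
qed

section \<open>Orders of magnitude at a small root\<close>

text \<open>Here \<open>s\<close> stands for \<open>real n powr (-1/2)\<close>. An odd polynomial
  has no constant term, so its value inherits the order \<open>s\<close> of its argument; higher
  powers of \<open>s\<close> are absorbed because \<open>s \<le> 1\<close>.\<close>

lemma abs_hermite3_le:
  assumes "\<bar>w\<bar> \<le> D * s" "0 \<le> D" "0 \<le> s" "s \<le> 1"
  shows "\<bar>hermite3 w\<bar> \<le> (D ^ 3 + 3 * D) * s"
proof -
  have "\<bar>hermite3 w\<bar> \<le> \<bar>w\<bar> ^ 3 + 3 * \<bar>w\<bar>"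
    using abs_triangle_ineq4[of "w ^ 3" "3 * w"] by (simp add: hermite3_def power_abs abs_mult)
  also have "\<dots> \<le> (D * s) ^ 3 + 3 * (D * s)"
    using assms(1) by (intro add_mono power_mono mult_left_mono) auto
  also have "\<dots> \<le> D ^ 3 * s + 3 * (D * s)"
    using assms power_decreasing[of 1 3 s] by (simp add: power_mult_distrib mult_left_mono)
  finally show ?thesis by (simp add: algebra_simps)
qed

lemma abs_hermite5_le:
  assumes "\<bar>w\<bar> \<le> D * s" "0 \<le> D" "0 \<le> s" "s \<le> 1"
  shows "\<bar>hermite5 w\<bar> \<le> (D ^ 5 + 10 * D ^ 3 + 15 * D) * s"
proof -
  have "\<bar>hermite5 w\<bar> \<le> \<bar>w ^ 5\<bar> + \<bar>10 * w ^ 3\<bar> + \<bar>15 * w\<bar>"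
    unfolding hermite5_def by linarith
  also have "\<dots> = \<bar>w\<bar> ^ 5 + 10 * \<bar>w\<bar> ^ 3 + 15 * \<bar>w\<bar>"
    by (simp add: power_abs abs_mult)
  also have "\<dots> \<le> (D * s) ^ 5 + 10 * (D * s) ^ 3 + 15 * (D * s)"
    using assms(1) by (intro add_mono power_mono mult_left_mono) auto
  also have "\<dots> \<le> D ^ 5 * s + 10 * (D ^ 3 * s) + 15 * (D * s)"
    using assms power_decreasing[of 1 3 s] power_decreasing[of 1 5 s]
    by (intro add_mono) (simp_all add: power_mult_distrib mult_left_mono)
  finally show ?thesis by (simp add: algebra_simps)
qed

text \<open>At the root, the first-order Edgeworth term equals \<open>w * std_normal_density w\<close>, which is the
  linear part of the distribution function at \<open>w\<close>.\<close>

lemma edgeworth_at_root: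
  assumes root: "w = \<rho> / 6 * (w\<^sup>2 - 1)"
    and w: "\<bar>w\<bar> \<le> D * s" and D: "0 \<le> D" and s: "0 \<le> s" "s \<le> 1"
    and a: "\<bar>a\<bar> \<le> A * s\<^sup>2" and b: "\<bar>b\<bar> \<le> A' * s\<^sup>2"
    and P: "\<bar>P - (cdf std_normal_distribution w - std_normal_density w *
              (\<rho> / 6 * (w\<^sup>2 - 1) + (a * hermite3 w + b * hermite5 w)))\<bar> \<le> C * s ^ 3"
  shows "\<bar>P - 1 / 2\<bar> \<le> (C + D ^ 3 + A * (D ^ 3 + 3 * D) + A' * (D ^ 5 + 10 * D ^ 3 + 15 * D)) * s ^ 3"
proof -
  let ?r = "a * hermite3 w + b * hermite5 w"
  let ?t = "cdf std_normal_distribution w - 1 / 2 - w * std_normal_density w"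
  have "\<bar>P - (1 / 2 + ?t - std_normal_density w * ?r)\<bar> \<le> C * s ^ 3"
    using P unfolding root[symmetric] by (simp add: algebra_simps)
  then have "\<bar>P - 1 / 2\<bar> \<le> C * s ^ 3 + \<bar>?t\<bar> + \<bar>std_normal_density w * ?r\<bar>" by linarith
  moreover have "\<bar>?t\<bar> \<le> D ^ 3 * s ^ 3"
    using cdf_std_normal_taylor[of w] power_mono[OF w, of 3] by (simp add: power_mult_distrib)
  moreover have "\<bar>std_normal_density w * ?r\<bar> \<le> \<bar>?r\<bar>"
    using mult_right_mono[OF std_normal_density_le_1, of "\<bar>?r\<bar>" w] by (simp add: abs_mult)
  moreover have "\<bar>?r\<bar> \<le> \<bar>a\<bar> * \<bar>hermite3 w\<bar> + \<bar>b\<bar> * \<bar>hermite5 w\<bar>"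
    using abs_triangle_ineq[of "a * hermite3 w" "b * hermite5 w"] by (simp add: abs_mult)
  moreover have "\<bar>a\<bar> * \<bar>hermite3 w\<bar> \<le> (A * s\<^sup>2) * ((D ^ 3 + 3 * D) * s)"
    using a by (intro mult_mono abs_hermite3_le w D s) auto
  moreover have "\<bar>b\<bar> * \<bar>hermite5 w\<bar> \<le> (A' * s\<^sup>2) * ((D ^ 5 + 10 * D ^ 3 + 15 * D) * s)"
    using b by (intro mult_mono abs_hermite5_le w D s) auto
  moreover have "(A * s\<^sup>2) * ((D ^ 3 + 3 * D) * s) = A * (D ^ 3 + 3 * D) * s ^ 3"
    "(A' * s\<^sup>2) * ((D ^ 5 + 10 * D ^ 3 + 15 * D) * s) = A' * (D ^ 5 + 10 * D ^ 3 + 15 * D) * s ^ 3"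
    by (simp_all add: power2_eq_square power3_eq_cube)
  ultimately have "\<bar>P - 1 / 2\<bar> \<le> C * s ^ 3 + D ^ 3 * s ^ 3 + A * (D ^ 3 + 3 * D) * s ^ 3
      + A' * (D ^ 5 + 10 * D ^ 3 + 15 * D) * s ^ 3" by linarith
  then show ?thesis by (simp only: distrib_right)
qed

section \<open>From the oracle root to the median\<close>

text \<open>The statistic is strictly decreasing in the candidate value, which turns an event about
  the estimate into one about \<open>W\<close> at the true value.\<close>

lemma le_iff_W_stat_le:
  assumes "K > 0"
  shows "t \<le> \<psi> \<longleftrightarrow> W_stat K B x \<psi> \<le> W_stat K B x t"
  using assms by (auto simp: W_stat_def)

text \<open>For a nonrandom quantity the probability of exceeding a bound is 0 or 1. Taking
  \<epsilon> = 1 excludes 1, so the bound holds deterministically.\<close>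

lemma bigo_in_prob_const_bound:
  assumes X: "bigo_in_prob M X s"
    and M: "\<And>n. prob_space (M n)"
  obtains D where "D \<ge> 0"
    "\<forall>\<^sub>F n in sequentially. \<forall>w. (\<forall>y\<in>space (M n). X n y = w) \<longrightarrow> 0 \<le> s n \<longrightarrow> \<bar>w\<bar> \<le> D * s n"
proof -
  obtain D where D: "\<forall>\<^sub>F n in sequentially. measure (M n) {y \<in> space (M n). \<bar>X n y\<bar> > D * s n} < 1"
    using X unfolding bigo_in_prob_def by (meson zero_less_one)
  \<comment> \<open>The maximum makes the constant nonnegative, as the Hermite bounds
    require.\<close>
  have "\<forall>\<^sub>F n in sequentially. \<forall>w. (\<forall>y\<in>space (M n). X n y = w) \<longrightarrow> 0 \<le> s n \<longrightarrow> \<bar>w\<bar> \<le> max D 0 * s n"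
    using D
  proof eventually_elim
    case (elim n)
    show ?case
    proof (intro allI impI)
      fix w assume w: "\<forall>y\<in>space (M n). X n y = w" and s: "0 \<le> s n"
      have "\<not> \<bar>w\<bar> > D * s n"
      proof
        assume "\<bar>w\<bar> > D * s n"
        then have "{y \<in> space (M n). \<bar>X n y\<bar> > D * s n} = space (M n)" using w by auto
        then show False using elim prob_space.prob_space[OF M, of n] by simp
      qed
      moreover have "D * s n \<le> max D 0 * s n" using s by (intro mult_right_mono) auto
      ultimately show "\<bar>w\<bar> \<le> max D 0 * s n" by linarith
    qed
  qed
  then show thesis by (intro that[of "max D 0"]) auto
qed

lemma median_unbiased_of_oracle_root:
  assumes M: "\<And>n. prob_space (M n)"
    and K: "\<forall>\<^sub>F n in sequentially. K n > 0"
    and E: "edgeworth_expansion M (\<lambda>n y. W_stat (K n) (B n) (X n y) \<psi>) \<rho>"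
    and R: "oracle_root M K \<rho> B X t"
  shows "(\<lambda>n. measure (M n) {y \<in> space (M n). t n y \<le> \<psi>} - 1 / 2) \<in> O(\<lambda>n. real n powr (-3/2))"
proof -
  obtain a b C where a: "a \<in> O(\<lambda>n. 1 / real n)" and b: "b \<in> O(\<lambda>n. 1 / real n)"
    and C: "\<forall>\<^sub>F n in sequentially. \<forall>x.
        \<bar>measure (M n) {y \<in> space (M n). W_stat (K n) (B n) (X n y) \<psi> \<le> x}
          - (cdf std_normal_distribution x - std_normal_density x *
              (\<rho> n / 6 * (x\<^sup>2 - 1) + (a n * hermite3 x + b n * hermite5 x)))\<bar>
        \<le> C * real n powr (-3/2)"
    using E unfolding edgeworth_expansion_def by blast
  obtain A where A: "\<forall>\<^sub>F n in sequentially. norm (a n) \<le> A * norm (1 / real n)"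
    using a by (elim landau_o.bigE)
  obtain A' where A': "\<forall>\<^sub>F n in sequentially. norm (b n) \<le> A' * norm (1 / real n)"
    using b by (elim landau_o.bigE)
  have Z: "\<forall>\<^sub>F n in sequentially. \<forall>y\<in>space (M n). Z_stat (K n) (\<rho> n) (B n) (X n y) (t n y) = 0"
    and const: "\<forall>\<^sub>F n in sequentially. \<exists>w. \<forall>y\<in>space (M n). W_stat (K n) (B n) (X n y) (t n y) = w"
    and op: "bigo_in_prob M (\<lambda>n y. W_stat (K n) (B n) (X n y) (t n y)) (\<lambda>n. real n powr (-1/2))"
    using R unfolding oracle_root_def by auto
  obtain D where D: "D \<ge> 0" and bound: "\<forall>\<^sub>F n in sequentially. \<forall>w.
      (\<forall>y\<in>space (M n). W_stat (K n) (B n) (X n y) (t n y) = w) \<longrightarrow> 0 \<le> real n powr (-1/2) \<longrightarrow>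
      \<bar>w\<bar> \<le> D * real n powr (-1/2)"
    by (rule bigo_in_prob_const_bound[OF op M])
  show ?thesis
  proof (rule bigoI)
    \<comment> \<open>In the constant, \<open>C\<close> is the error of the expansion,
      \<open>D ^ 3\<close> the cubic remainder of the distribution function, and the other two terms
      come from the Hermite polynomials.\<close>
    show "\<forall>\<^sub>F n in sequentially.
      norm (measure (M n) {y \<in> space (M n). t n y \<le> \<psi>} - 1 / 2)
      \<le> (C + D ^ 3 + A * (D ^ 3 + 3 * D) + A' * (D ^ 5 + 10 * D ^ 3 + 15 * D))
          * norm (real n powr (-3/2))"
      using K C A A' Z const bound eventually_ge_at_top[of 1]
    proof eventually_elim
      case (elim n)
      \<comment> \<open>The three rates become \<open>s\<close>, \<open>s\<^sup>2\<close> and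
        \<open>s ^ 3\<close>, which leaves polynomial estimates; \<open>n \<ge> 1\<close> gives
        \<open>s \<le> 1\<close>.\<close>
      define s where "s = real n powr (-1/2)"
      have s3: "real n powr (-3/2) = s ^ 3"
        by (simp only: s_def power3_eq_cube flip: powr_add) simp
      have s: "0 \<le> s" "s \<le> 1" "1 / real n = s\<^sup>2"
        using elim(8) powr_mono[of "-1/2" 0 "real n"]
        by (simp_all add: s_def power2_eq_square powr_minus_divide flip: powr_add)
      from elim(6) obtain w
        where w: "\<And>y. y \<in> space (M n) \<Longrightarrow> W_stat (K n) (B n) (X n y) (t n y) = w" by blast
      have wD: "\<bar>w\<bar> \<le> D * s" using elim(7) w by (simp add: s_def)
      \<comment> \<open>A probability space has a sample point; evaluating \<open>Z = 0\<close>
        there yields the equation for the constant \<open>w\<close>.\<close>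
      obtain y where y: "y \<in> space (M n)" using prob_space.not_empty[OF M, of n] by blast
      have root: "w = \<rho> n / 6 * (w\<^sup>2 - 1)"
        using elim(5) y w[OF y] by (auto simp: Z_stat_def)
      \<comment> \<open>The threshold \<open>w\<close> is the same at all sample points, so the
        event is a half-line event for \<open>W\<close> and the uniform expansion can be evaluated
        at \<open>w\<close>.\<close>
      have "{y \<in> space (M n). t n y \<le> \<psi>}
          = {y \<in> space (M n). W_stat (K n) (B n) (X n y) \<psi> \<le> w}"
        using w le_iff_W_stat_le[OF elim(1), where B = "B n"] by (intro Collect_cong) metis
      moreover have "\<bar>measure (M n) {y \<in> space (M n). W_stat (K n) (B n) (X n y) \<psi> \<le> w} - 1 / 2\<bar>
          \<le> (C + D ^ 3 + A * (D ^ 3 + 3 * D) + A' * (D ^ 5 + 10 * D ^ 3 + 15 * D)) * s ^ 3"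
        using elim(2) elim(3,4) s s3
        by (intro edgeworth_at_root[OF root wD D s(1,2)]) auto
      ultimately show ?case using s s3 by simp
    qed
  qed
qed

theorem theorem1:
  fixes \<Theta> :: "(real ^ 'p::finite) set" and \<theta> :: "real ^ 'p"
    and d :: "nat \<Rightarrow> nat" and S :: "nat \<Rightarrow> (nat \<Rightarrow> real) set"
    and l :: "nat \<Rightarrow> real ^ 'p \<Rightarrow> (nat \<Rightarrow> real) \<Rightarrow> real"
    and M :: "nat \<Rightarrow> real ^ 'p \<Rightarrow> (nat \<Rightarrow> real) measure"
    and h :: "real ^ 'p \<Rightarrow> real" and H :: "real set"
    and \<theta>hat :: "nat \<Rightarrow> (nat \<Rightarrow> real) \<Rightarrow> real ^ 'p"
    and \<psi>hat \<psi>tilde W :: "nat \<Rightarrow> (nat \<Rightarrow> real) \<Rightarrow> real"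
    and \<psi> :: real and B K\<^sub>2 K\<^sub>3 \<rho>\<^sub>3 :: "nat \<Rightarrow> real"
    and k m :: nat
  assumes \<comment> \<open>the model\<close>
        "\<theta> \<in> interior \<Theta>"
    and "\<And>n. S n \<in> sets (\<Pi>\<^sub>M i\<in>{..<d n}. lborel)"
    and "\<And>n t. t \<in> \<Theta> \<Longrightarrow> l n t \<in> borel_measurable (restrict_space (\<Pi>\<^sub>M i\<in>{..<d n}. lborel) (S n))"
    and "\<And>n t. M n t = lik_model (d n) (S n) (l n t)"
    and "\<And>n t. t \<in> \<Theta> \<Longrightarrow> prob_space (M n t)"
    \<comment> \<open>smoothness and moments of log-likelihood derivatives, up to arbitrary orders k and m\<close>
    and "\<And>n y. y \<in> S n \<Longrightarrow> Ck_on k (\<lambda>t. l n t y) (interior \<Theta>)"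
    and "\<And>jss. \<forall>js\<in>set jss. 1 \<le> length js \<and> length js \<le> k \<Longrightarrow> length jss \<le> m \<Longrightarrow>
          \<forall>\<^sub>F n in sequentially.
            integrable (M n \<theta>) (\<lambda>y. \<Prod>js\<leftarrow>jss. iter_partial (\<lambda>t. l n t y) js \<theta>)"
    \<comment> \<open>the focus parameter\<close>
    and "h \<in> \<Theta> \<rightarrow> H" and "smooth_on h \<Theta>"
    and "\<psi> = h \<theta>"
    \<comment> \<open>maximum likelihood estimation\<close>
    and "\<forall>\<^sub>F n in sequentially. \<theta>hat n \<in> borel_measurable (M n \<theta>)"
    and "\<forall>\<^sub>F n in sequentially. AE y in M n \<theta>. is_arg_max (\<lambda>t. l n t y) (\<lambda>t. t \<in> \<Theta>) (\<theta>hat n y)"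
    and "\<And>n y. \<psi>hat n y = h (\<theta>hat n y)"
    and "\<forall>\<^sub>F n in sequentially. \<psi>hat n \<in> borel_measurable (M n \<theta>)"
    and "\<forall>\<^sub>F n in sequentially. integrable (M n \<theta>) (\<lambda>y. \<bar>\<psi>hat n y\<bar> ^ 3)"
    \<comment> \<open>cumulants of the maximum likelihood estimator\<close>
    and "\<And>n. B n = (LINT y|M n \<theta>. \<psi>hat n y - \<psi>)"
    and "\<And>n. K\<^sub>2 n = variance_of (M n \<theta>) (\<psi>hat n)"
    and "\<And>n. K\<^sub>3 n = cum3 (M n \<theta>) (\<psi>hat n)"
    and "\<And>n. \<rho>\<^sub>3 n = K\<^sub>2 n powr (-3/2) * K\<^sub>3 n"
    and "\<And>n y. W n y = W_stat (K\<^sub>2 n) (B n) (\<psi>hat n y) \<psi>"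
    and "B \<in> O(\<lambda>n. 1 / real n)"
    and "\<forall>\<^sub>F n in sequentially. K\<^sub>2 n > 0" and "K\<^sub>2 \<in> O(\<lambda>n. 1 / real n)"
    and "\<rho>\<^sub>3 \<in> O(\<lambda>n. real n powr (-1/2))"
    and "weak_conv_m (\<lambda>n. distr (M n \<theta>) borel (W n)) std_normal_distribution"
    and "edgeworth_expansion (\<lambda>n. M n \<theta>) W \<rho>\<^sub>3"
    \<comment> \<open>the oracle estimator\<close>
    and "oracle_root (\<lambda>n. M n \<theta>) K\<^sub>2 \<rho>\<^sub>3 B \<psi>hat \<psi>tilde"
  shows "(\<lambda>n. measure (M n \<theta>) {y \<in> space (M n \<theta>). \<psi>tilde n y \<le> \<psi>} - 1 / 2)
          \<in> O(\<lambda>n. real n powr (-3/2))"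
proof (rule median_unbiased_of_oracle_root)
  have "\<theta> \<in> \<Theta>" using assms(1) interior_subset by blast
  then show "prob_space (M n \<theta>)" for n by (rule assms(5))
  have "W = (\<lambda>n y. W_stat (K\<^sub>2 n) (B n) (\<psi>hat n y) \<psi>)"
    by (intro ext) (rule assms(20))
  then show "edgeworth_expansion (\<lambda>n. M n \<theta>) (\<lambda>n y. W_stat (K\<^sub>2 n) (B n) (\<psi>hat n y) \<psi>) \<rho>\<^sub>3"
    using assms(26) by simp
qed (rule assms(22) assms(27))+

end
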